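(* Let $(X,d)$ be a nonempty complete doubling metric space. Then for every $\varepsilon>0$ there is a doubling measure $\mu$ on $X$ such that \[ \overline{\dim}_{\mathrm{loc}}(\mu,x)\le\varepsilon \] for $\mu$-almost all $x\in X$.
   Context: In a metric space $(X,d)$, $B(x,t)=\{y\in X : d(x,y)\le t\}$ denotes the closed ball with centre $x\in X$ and radius $t>0$. The metric space $X$ is doubling if there is $N\in\mathbb{N}$ such that for every $x\in X$ and $t>0$ the ball $B(x,2t)$ can be covered by at most $N$ closed balls of radius $t$. A measure on $X$ means a Borel regular outer measure on $X$. A measure $\mu$ on $X$ is called doubling if there is a constant $1\le D<\infty$ such that $0<\mu(B(x,2t))\le D\,\mu(B(x,t))<\infty$ for all $x\in X$ and $t>0$. The upper local dimension of $\mu$ at $x$ is \[ \overline{\dim}_{\mathrm{loc}}(\mu,x)=\limsup_{t\downarrow 0}\frac{\log\mu(B(x,t))}{\log t}. \] *)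

theory Defs
  imports "HOL-Analysis.Analysis"
begin

text \<open>The metric space is the whole of a type of class \<^class>\<open>metric_space\<close>;
  closed balls are \<^const>\<open>cball\<close>, which contain their boundary spheres.\<close>

definition doubling_space :: "'a::metric_space itself \<Rightarrow> bool" where
  "doubling_space _ \<longleftrightarrow>
    (\<exists>N::nat. \<forall>(x::'a) t. t > 0 \<longrightarrow>
      (\<exists>C. finite C \<and> card C \<le> N \<and> cball x (2 * t) \<subseteq> (\<Union>c\<in>C. cball c t)))"

text \<open>Measures are Borel regular outer measures, defined on all subsets of the space.
  The library predicate \<^const>\<open>countably_subadditive\<close> only mentions disjoint families;
  together with monotonicity on the full power set this gives
  countable subadditivity for arbitrary families.
  \<^const>\<open>lambda_system\<close> is the collection of Caratheodory measurable sets.\<close>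

definition borel_regular_outer_measure :: "('a::topological_space set \<Rightarrow> ennreal) \<Rightarrow> bool" where
  "borel_regular_outer_measure \<mu> \<longleftrightarrow>
    outer_measure_space UNIV \<mu> \<and>
    sets borel \<subseteq> lambda_system UNIV UNIV \<mu> \<and>
    (\<forall>A. \<exists>B \<in> sets borel. A \<subseteq> B \<and> \<mu> B = \<mu> A)"

definition doubling_measure :: "('a::metric_space set \<Rightarrow> ennreal) \<Rightarrow> bool" where
  "doubling_measure \<mu> \<longleftrightarrow>
    borel_regular_outer_measure \<mu> \<and>
    (\<exists>D::real. D \<ge> 1 \<and>
      (\<forall>x t. t > 0 \<longrightarrow>
        0 < \<mu> (cball x (2 * t)) \<and>
        \<mu> (cball x (2 * t)) \<le> ennreal D * \<mu> (cball x t) \<and>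
        ennreal D * \<mu> (cball x t) < \<infinity>))"

definition log_ennreal :: "ennreal \<Rightarrow> ereal" where
  "log_ennreal a = (if a = 0 then - \<infinity> else if a = \<infinity> then \<infinity> else ereal (ln (enn2real a)))"

definition upper_local_dim :: "('a::metric_space set \<Rightarrow> ennreal) \<Rightarrow> 'a \<Rightarrow> ereal" where
  "upper_local_dim \<mu> x =
    Limsup (at_right 0) (\<lambda>t::real. log_ennreal (\<mu> (cball x t)) / ereal (ln t))"

text \<open>The exceptional set need not be Borel, so ``almost all'' refers to the outer measure.\<close>

definition almost_all :: "('a set \<Rightarrow> ennreal) \<Rightarrow> ('a \<Rightarrow> bool) \<Rightarrow> bool" where
  "almost_all \<mu> P \<longleftrightarrow> \<mu> {x. \<not> P x} = 0"

end

(*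
  Choose nets X n at the scales 16^-n, n an integer, and join them to a tree: every point of
  X (n + 1) gets a nearby parent in X n, and each x in X n has one central child next to it.
  Mass is passed down the tree, each non-central child receiving the fixed fraction p of its
  parent's mass and the central child the (large) rest. Descendants of a central child stay well
  inside the region of its parent. Hence two nearby points of the same net have only non-central
  ancestors below the place where their lines of ancestors meet (up to boundedly many steps), so
  their masses are comparable, and the limit measure is doubling. For small p almost all
  lines of descent are central most of the time, which keeps the mass of small balls large.
  The limit measure is the image of Lebesgue measure on a union of real intervals that is
  subdivided according to the tree; completeness makes the coding map converge.
*)
theory Submission
  imports Defs
begin

subsection \<open>Outer measures from Borel measures\<close>

text \<open>Every set has a measurable hull of the same outer measure, so each property reduces to
  the measure on hulls. For Caratheodory measurability of \<open>L\<close>, one inequality cuts a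
  hull of \<open>A\<close> along \<open>L\<close>, the other unites hulls of the two pieces.\<close>

lemma borel_regular_outer_measure_of:
  fixes M :: "'a::topological_space measure"
  assumes sets_M: "sets M = sets borel"
  shows "borel_regular_outer_measure (outer_measure_of M)"
  unfolding borel_regular_outer_measure_def
proof (intro conjI allI subsetI)
  have space_M: "space M = UNIV"
    using sets_eq_imp_space_eq[OF sets_M] by simp
  have attain: "\<exists>E\<in>sets M. A \<subseteq> E \<and> outer_measure_of M A = emeasure M E" for A
    by (rule outer_measure_of_attain) (simp add: space_M)
  have mono: "outer_measure_of M A \<le> outer_measure_of M B" if "A \<subseteq> B" for A B
    using that by (rule outer_measure_of_mono)
  have le: "outer_measure_of M A \<le> emeasure M B" if "A \<subseteq> B" "B \<in> sets M" for A B
    using mono[OF that(1)] that(2) by simp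
  have subadd: "outer_measure_of M (\<Union>i. A i) \<le> (\<Sum>i. outer_measure_of M (A i))" for A :: "nat \<Rightarrow> _"
  proof -
    obtain E where E: "\<And>i. E i \<in> sets M" "\<And>i. A i \<subseteq> E i"
      "\<And>i. outer_measure_of M (A i) = emeasure M (E i)"
      using attain[of "A _"] by metis
    have "outer_measure_of M (\<Union>i. A i) \<le> emeasure M (\<Union>i. E i)"
      using E by (intro le) auto
    also have "\<dots> \<le> (\<Sum>i. emeasure M (E i))"
      using E by (intro emeasure_subadditive_countably) auto
    finally show ?thesis using E(3) by simp
  qed
  then show "outer_measure_space UNIV (outer_measure_of M)"
    unfolding outer_measure_space_def positive_def increasing_def countably_subadditive_def
    using mono by auto
  show "\<exists>B\<in>sets borel. A \<subseteq> B \<and> outer_measure_of M B = outer_measure_of M A" for A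
    using attain[of A] sets_M by auto
  fix L :: "'a set" assume "L \<in> sets borel"
  then have L: "L \<in> sets M" using sets_M by simp
  have "outer_measure_of M (L \<inter> A) + outer_measure_of M ((UNIV - L) \<inter> A) = outer_measure_of M A" for A
  proof (rule antisym)
    obtain E where E: "E \<in> sets M" "A \<subseteq> E" "outer_measure_of M A = emeasure M E"
      using attain by metis
    have "outer_measure_of M (L \<inter> A) + outer_measure_of M ((UNIV - L) \<inter> A)
        \<le> emeasure M (L \<inter> E) + emeasure M (E - L)"
      using E L by (intro add_mono le) auto
    also have "\<dots> = emeasure M E"
      using E L by (subst plus_emeasure) (auto intro!: arg_cong[where f="emeasure M"])
    finally show "outer_measure_of M (L \<inter> A) + outer_measure_of M ((UNIV - L) \<inter> A)
        \<le> outer_measure_of M A"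
      using E by simp
    obtain F where F: "F \<in> sets M" "L \<inter> A \<subseteq> F" "outer_measure_of M (L \<inter> A) = emeasure M F"
      using attain by metis
    obtain G where G: "G \<in> sets M" "(UNIV - L) \<inter> A \<subseteq> G"
      "outer_measure_of M ((UNIV - L) \<inter> A) = emeasure M G"
      using attain by metis
    have "outer_measure_of M A \<le> emeasure M (F \<union> G)"
      using F G by (intro le) auto
    also have "\<dots> \<le> emeasure M F + emeasure M G"
      using F G by (intro emeasure_subadditive) auto
    finally show "outer_measure_of M A
        \<le> outer_measure_of M (L \<inter> A) + outer_measure_of M ((UNIV - L) \<inter> A)"
      using F G by simp
  qed
  then show "L \<in> lambda_system UNIV UNIV (outer_measure_of M)"
    unfolding lambda_system_def by simp
qed

subsection \<open>Splitting intervals\<close>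

text \<open>The intervals are laid end to end; being half-open, they tile exactly and stay
  disjoint.\<close>

lemma interval_split_finite:
  fixes W :: "'b \<Rightarrow> real" and l :: real
  assumes "finite S" "\<And>y. y \<in> S \<Longrightarrow> 0 \<le> W y"
  shows "\<exists>g. {l..<l + sum W S} = (\<Union>y\<in>S. {g y..<g y + W y}) \<and>
           disjoint_family_on (\<lambda>y. {g y..<g y + W y}) S"
  using assms
proof (induction S arbitrary: l rule: finite_induct)
  case empty
  then show ?case by (simp add: disjoint_family_on_def)
next
  case (insert x S)
  obtain g where g: "{l + W x..<l + W x + sum W S} = (\<Union>y\<in>S. {g y..<g y + W y})"
    "disjoint_family_on (\<lambda>y. {g y..<g y + W y}) S"
    using insert.IH[of "l + W x"] insert.prems by auto
  define g' where "g' = g(x := l)"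
  have g'S: "g' y = g y" if "y \<in> S" for y
    using that insert.hyps by (auto simp: g'_def)
  have U: "(\<Union>y\<in>S. {g' y..<g' y + W y}) = {l + W x..<l + W x + sum W S}"
    using g(1) g'S by auto
  have pos: "0 \<le> W x" "0 \<le> sum W S"
    using insert.prems by (auto intro: sum_nonneg)
  have "{l..<l + sum W (insert x S)} = {l..<l + W x} \<union> {l + W x..<l + W x + sum W S}"
    using insert.hyps pos by auto
  also have "\<dots> = (\<Union>y\<in>insert x S. {g' y..<g' y + W y})"
    using U by (auto simp: g'_def)
  finally have "{l..<l + sum W (insert x S)} = (\<Union>y\<in>insert x S. {g' y..<g' y + W y})" .
  moreover have "disjoint_family_on (\<lambda>y. {g' y..<g' y + W y}) (insert x S)"
  proof -
    have "disjoint_family_on (\<lambda>y. {g' y..<g' y + W y}) S"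
      using g(2) g'S unfolding disjoint_family_on_def by simp
    moreover have "{g' x..<g' x + W x} \<inter> (\<Union>y\<in>S. {g' y..<g' y + W y}) = {}"
      unfolding U by (auto simp: g'_def)
    ultimately show ?thesis
      using insert.hyps(2) by (simp add: disjoint_family_on_insert)
  qed
  ultimately show ?case by blast
qed

text \<open>Enumerate \<open>S\<close> and start the interval of \<open>y\<close> at the total
  length of those before it. Only finite sums occur, so the total length may be infinite.\<close>

lemma disjoint_intervals_countable:
  fixes W :: "'b \<Rightarrow> real"
  assumes "countable S" "\<And>y. y \<in> S \<Longrightarrow> 0 \<le> W y"
  shows "\<exists>g. disjoint_family_on (\<lambda>y. {g y..<g y + W y}) S"
proof -
  define e where "e = to_nat_on S"
  define T where "T y = {z\<in>S. e z < e y}" for y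
  have e: "inj_on e S"
    unfolding e_def using assms(1) by (rule inj_on_to_nat_on)
  have fin: "finite (T y)" for y
    by (rule finite_imageD[of e])
      (auto simp: T_def intro: finite_subset[of _ "{..<e y}"] inj_on_subset[OF e])
  have step: "sum W (T x) + W x \<le> sum W (T y)" if "x \<in> S" "y \<in> S" "e x < e y" for x y
  proof -
    have "sum W (T x) + W x = sum W (insert x (T x))"
      using fin by (subst sum.insert) (auto simp: T_def)
    also have "\<dots> \<le> sum W (T y)"
      using that fin assms(2) by (intro sum_mono2) (auto simp: T_def)
    finally show ?thesis .
  qed
  have "disjoint_family_on (\<lambda>y. {sum W (T y)..<sum W (T y) + W y}) S"
    unfolding disjoint_family_on_def
  proof (intro ballI impI)
    fix x y assume xy: "x \<in> S" "y \<in> S" "x \<noteq> y"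
    then have "e x < e y \<or> e y < e x"
      using e by (meson inj_on_def linorder_neqE_nat)
    then show "{sum W (T x)..<sum W (T x) + W x} \<inter> {sum W (T y)..<sum W (T y) + W y} = {}"
      using step[of x y] step[of y x] xy by force
  qed
  then show ?thesis by (rule exI[where x="\<lambda>y. sum W (T y)"])
qed

subsection \<open>Separated nets in doubling spaces\<close>

definition separated :: "real \<Rightarrow> 'a::metric_space set \<Rightarrow> bool" where
  "separated s A \<longleftrightarrow> (\<forall>x\<in>A. \<forall>y\<in>A. x \<noteq> y \<longrightarrow> s \<le> dist x y)"

text \<open>Zorn's lemma: a point at distance at least \<open>s\<close> from a maximal separated set
  could be added to it. Prescribing \<open>z\<close> later places \<open>base\<close> in every
  net.\<close>

lemma maximal_separated_exists:
  fixes z :: "'a::metric_space"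
  assumes "s > 0"
  shows "\<exists>A. z \<in> A \<and> separated s A \<and> (\<forall>x. \<exists>a\<in>A. dist x a < s)"
proof -
  let ?F = "{A. z \<in> A \<and> separated s A}"
  have "\<exists>A\<in>?F. \<forall>B\<in>?F. A \<subseteq> B \<longrightarrow> B = A"
  proof (rule subset_Zorn_nonempty)
    show "?F \<noteq> {}"
      by (auto intro!: exI[of _ "{z}"] simp: separated_def)
    fix C assume C: "C \<noteq> {}" "subset.chain ?F C"
    have "separated s (\<Union>C)"
      unfolding separated_def
    proof (intro ballI impI)
      fix x y assume "x \<in> \<Union>C" "y \<in> \<Union>C" and ne: "x \<noteq> y"
      then obtain A B where AB: "A \<in> C" "x \<in> A" "B \<in> C" "y \<in> B" by auto
      then have "A \<subseteq> B \<or> B \<subseteq> A" "separated s A" "separated s B"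
        using C(2) unfolding subset_chain_def by blast+
      then show "s \<le> dist x y"
        using AB ne unfolding separated_def by blast
    qed
    then show "\<Union>C \<in> ?F"
      using C unfolding subset_chain_def by blast
  qed
  then obtain A where A: "z \<in> A" "separated s A"
    and max: "\<And>B. z \<in> B \<Longrightarrow> separated s B \<Longrightarrow> A \<subseteq> B \<Longrightarrow> B = A" by auto
  have "\<exists>a\<in>A. dist x a < s" for x
  proof (rule ccontr)
    assume far: "\<not> (\<exists>a\<in>A. dist x a < s)"
    then have "separated s (insert x A)"
      using A(2) unfolding separated_def by (auto simp: dist_commute not_less)
    then have "insert x A = A" using A(1) by (intro max) auto
    then show False using far \<open>s > 0\<close> by (metis dist_self insertI1)
  qed
  then show ?thesis using A by blast
qed

lemma doubling_space_cover_power: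
  assumes N: "\<And>(x::'a::metric_space) t. t > 0 \<Longrightarrow>
      \<exists>C. finite C \<and> card C \<le> N \<and> cball x (2 * t) \<subseteq> (\<Union>c\<in>C. cball c t)"
    and "t > 0"
  shows "\<exists>C. finite C \<and> card C \<le> N ^ k \<and> cball (x::'a) (2 ^ k * t) \<subseteq> (\<Union>c\<in>C. cball c t)"
  using \<open>t > 0\<close>
proof (induction k arbitrary: t)
  case 0
  show ?case by (rule exI[of _ "{x}"]) auto
next
  case (Suc k)
  from Suc.IH[of "2 * t"] Suc.prems obtain C where C: "finite C" "card C \<le> N ^ k"
    "cball x (2 ^ k * (2 * t)) \<subseteq> (\<Union>c\<in>C. cball c (2 * t))" by auto
  obtain D where D: "\<And>c. finite (D c)" "\<And>c. card (D c) \<le> N"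
    "\<And>c::'a. cball c (2 * t) \<subseteq> (\<Union>d\<in>D c. cball d t)"
    using N[OF Suc.prems] by metis
  show ?case
  proof (intro exI[of _ "\<Union>c\<in>C. D c"] conjI)
    show "finite (\<Union>c\<in>C. D c)" using C D by auto
    have "card (\<Union>c\<in>C. D c) \<le> (\<Sum>c\<in>C. card (D c))"
      using C by (intro card_UN_le) auto
    also have "\<dots> \<le> card C * N"
      using sum_bounded_above[of C "\<lambda>c. card (D c)" N] D by simp
    also have "\<dots> \<le> N ^ Suc k"
      using C by simp
    finally show "card (\<Union>c\<in>C. D c) \<le> N ^ Suc k" .
    have "cball x (2 ^ Suc k * t) = cball x (2 ^ k * (2 * t))" by (simp add: mult_ac)
    also have "\<dots> \<subseteq> (\<Union>c\<in>C. \<Union>d\<in>D c. cball d t)"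
      using C(3) D(3) by (meson UN_mono order_refl order_trans)
    finally show "cball x (2 ^ Suc k * t) \<subseteq> (\<Union>d\<in>\<Union>c\<in>C. D c. cball d t)" by simp
  qed
qed

text \<open>Cover the ball by balls of radius \<open>s / 4\<close>. Each has diameter at most
  \<open>s / 2\<close>, so it holds at most one point of \<open>A\<close>; \<open>k + 2\<close>
  halvings lead from radius \<open>2 ^ k * s\<close> to \<open>s / 4\<close>.\<close>

lemma doubling_space_packing:
  assumes "doubling_space TYPE('a::metric_space)"
  shows "\<exists>N::nat. \<forall>s>0. \<forall>A x k. separated s A \<longrightarrow>
     finite (A \<inter> cball (x::'a) (2 ^ k * s)) \<and> card (A \<inter> cball x (2 ^ k * s)) \<le> N ^ (k + 2)"
proof -
  obtain N where N: "\<And>(x::'a::metric_space) t. t > 0 \<Longrightarrow>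
      \<exists>C. finite C \<and> card C \<le> N \<and> cball x (2 * t) \<subseteq> (\<Union>c\<in>C. cball c t)"
    using assms unfolding doubling_space_def by blast
  have "finite (A \<inter> cball x (2 ^ k * s)) \<and> card (A \<inter> cball x (2 ^ k * s)) \<le> N ^ (k + 2)"
    if s: "s > 0" and A: "separated s A" for s A k and x :: 'a
  proof -
    obtain C where C: "finite C" "card C \<le> N ^ (k + 2)"
      "cball x (2 ^ (k + 2) * (s / 4)) \<subseteq> (\<Union>c\<in>C. cball c (s / 4))"
      using doubling_space_cover_power[OF N, of "s / 4" "k + 2" x] s by auto
    let ?B = "A \<inter> cball x (2 ^ k * s)"
    have "\<exists>c\<in>C. dist c y \<le> s / 4" if "y \<in> ?B" for y
      using that C(3) by (auto simp: subset_iff)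
    then obtain f where f: "\<And>y. y \<in> ?B \<Longrightarrow> f y \<in> C \<and> dist (f y) y \<le> s / 4" by metis
    have "inj_on f ?B"
    proof (rule inj_onI, rule ccontr)
      fix y z assume yz: "y \<in> ?B" "z \<in> ?B" "f y = f z" "y \<noteq> z"
      then have "s \<le> dist y z" using A unfolding separated_def by auto
      moreover have "dist y z \<le> dist (f y) y + dist (f z) z"
        using dist_triangle3[of y z "f y"] yz(3) by simp
      ultimately show False using f[OF yz(1)] f[OF yz(2)] s by auto
    qed
    moreover have "f ` ?B \<subseteq> C" using f by auto
    ultimately show ?thesis
      using C card_inj_on_le[of f ?B C] inj_on_finite[of f ?B C] by simp
  qed
  then show ?thesis by blast
qed

section \<open>Scales of the nets\<close>

definition mesh :: "int \<Rightarrow> real" where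
  "mesh n = 16 powr (- real_of_int n)"

lemma mesh_pos [simp]: "0 < mesh n"
  by (simp add: mesh_def)

lemma mesh_add1: "mesh (n + 1) = mesh n / 16"
  by (simp add: mesh_def powr_diff powr_minus field_simps flip: powr_add)

lemma mesh_le: "m \<le> n \<Longrightarrow> mesh n \<le> mesh m"
  by (simp add: mesh_def)

lemma mesh_of_nat: "mesh (int n) = (1 / 16) ^ n"
  by (simp add: mesh_def powr_minus powr_realpow power_one_over inverse_eq_divide)

lemma mesh_tendsto_0: "(\<lambda>n. mesh (int n)) \<longlonglongrightarrow> 0"
  by (simp add: mesh_of_nat LIMSEQ_power_zero)

lemma mesh_between:
  assumes "0 < r"
  shows "\<exists>n. mesh n \<le> r \<and> r < 16 * mesh n"
proof -
  define n where "n = \<lceil>- log 16 r\<rceil>"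
  have "- log 16 r \<le> n" "n - 1 < - log 16 r"
    unfolding n_def by linarith+
  then have "- real_of_int n \<le> log 16 r" "log 16 r < 1 + - real_of_int n" by linarith+
  then have "16 powr (- real_of_int n) \<le> r" "r < 16 powr (1 + - real_of_int n)"
    using assms by (simp_all add: le_log_iff log_less_iff)
  then show ?thesis
    unfolding mesh_def powr_add by auto
qed

text \<open>This is why levels are integers: negative levels supply arbitrarily coarse scales, on
  which lines of ancestors meet even in an unbounded space.\<close>

lemma mesh_unbounded: "\<exists>k. r < mesh (n - int k)"
proof -
  obtain k where k: "r / mesh n < 16 ^ k"
    using real_arch_pow[of "16::real" "r / mesh n"] by auto
  have "mesh (n - int k) = 16 ^ k * mesh n"
    by (simp add: mesh_def powr_diff powr_minus powr_realpow field_simps)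
  then show ?thesis
    using k by (intro exI[of _ k]) (simp add: field_simps)
qed

subsection \<open>Trees of nets\<close>

text \<open>The radius factor 200 leaves room for the constant 131 of the doubling estimate
  and is below the 256 that makes two levels suffice in \<open>path_wt_comparable\<close>.\<close>

locale net_tree =
  fixes X :: "int \<Rightarrow> 'a::complete_space set"
    and par cen :: "int \<Rightarrow> 'a \<Rightarrow> 'a" and base :: 'a and p :: real and M :: nat
  assumes base_in: "base \<in> X n"
    and dense: "\<exists>x\<in>X n. dist z x < mesh n"
    and countable_X: "countable (X n)"
    and finite_near: "finite {y\<in>X n. dist x y \<le> 200 * mesh n}"
    and card_near: "card {y\<in>X n. dist x y \<le> 200 * mesh n} \<le> M"
    and par_in: "y \<in> X (n + 1) \<Longrightarrow> par n y \<in> X n"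
    and par_dist: "y \<in> X (n + 1) \<Longrightarrow> dist y (par n y) < mesh n"
    and par_near: "y \<in> X (n + 1) \<Longrightarrow> x \<in> X n \<Longrightarrow> dist y x < mesh n / 2 \<Longrightarrow> par n y = x"
    and cen_in: "x \<in> X n \<Longrightarrow> cen n x \<in> X (n + 1)"
    and cen_dist: "x \<in> X n \<Longrightarrow> dist x (cen n x) < mesh (n + 1)"
    and p_pos: "0 < p"
    and p_le: "p * (real M + 1) \<le> 1"

text \<open>The nets, parents and \<open>M\<close> are fixed before \<open>p\<close>, so
  \<open>p\<close> can later be chosen small in terms of \<open>M\<close>.\<close>

lemma net_tree_exists:
  assumes "doubling_space TYPE('a::complete_space)"
  shows "\<exists>X par cen M. \<forall>p>0. p * (real M + 1) \<le> 1 \<longrightarrow> net_tree X par cen (base::'a) p M"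
proof -
  obtain N :: nat where N: "\<And>s A (x::'a) k. s > 0 \<Longrightarrow> separated s A \<Longrightarrow>
     finite (A \<inter> cball x (2 ^ k * s)) \<and> card (A \<inter> cball x (2 ^ k * s)) \<le> N ^ (k + 2)"
    using doubling_space_packing[OF assms] by meson
  have "\<exists>A. base \<in> A \<and> separated (mesh n) A \<and> (\<forall>x. \<exists>a\<in>A. dist x a < mesh n)" for n
    by (rule maximal_separated_exists) simp
  then obtain X where X: "\<And>n. base \<in> X n" "\<And>n. separated (mesh n) (X n)"
    "\<And>n x. \<exists>a\<in>X n. dist x a < mesh n" by metis
  \<comment> \<open>The parent is the net point within half a mesh if there is one, unique because
    net points are a full mesh apart; otherwise it is any net point within a mesh.\<close>
  have "\<exists>x. x \<in> X n \<and> dist y x < mesh n \<and> (\<forall>z\<in>X n. dist y z < mesh n / 2 \<longrightarrow> x = z)" for n y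
  proof (cases "\<exists>x\<in>X n. dist y x < mesh n / 2")
    case True
    then obtain x where x: "x \<in> X n" "dist y x < mesh n / 2" by auto
    have "x = z" if "z \<in> X n" "dist y z < mesh n / 2" for z
    proof (rule ccontr)
      assume "x \<noteq> z"
      then have "mesh n \<le> dist x z" using X(2)[of n] x that unfolding separated_def by auto
      then show False using dist_triangle3[of x z y] x that by linarith
    qed
    moreover have "dist y x < mesh n" using x(2) mesh_pos[of n] by linarith
    ultimately show ?thesis using x(1) by blast
  next
    case False
    then show ?thesis using X(3)[of n y] by auto
  qed
  then obtain par where par: "\<And>n y. par n y \<in> X n" "\<And>n y. dist y (par n y) < mesh n"
    "\<And>n y z. z \<in> X n \<Longrightarrow> dist y z < mesh n / 2 \<Longrightarrow> par n y = z" by metis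
  obtain cen where cen: "\<And>n x. cen n x \<in> X (n + 1)" "\<And>n x. dist x (cen n x) < mesh (n + 1)"
    using X(3)[of "_ + 1"] by metis
  \<comment> \<open>\<open>2 ^ 8\<close> is the first power of two above 200, and the packing bound
    adds 2 to the exponent.\<close>
  have near: "finite {y\<in>X n. dist x y \<le> 200 * mesh n}"
    "card {y\<in>X n. dist x y \<le> 200 * mesh n} \<le> N ^ 10" for n x
  proof -
    have fin: "finite (X n \<inter> cball x (2 ^ 8 * mesh n))"
      and card: "card (X n \<inter> cball x (2 ^ 8 * mesh n)) \<le> N ^ 10"
      using N[OF mesh_pos X(2), of n x 8] by auto
    have sub: "{y\<in>X n. dist x y \<le> 200 * mesh n} \<subseteq> X n \<inter> cball x (2 ^ 8 * mesh n)"
    proof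
      fix y assume "y \<in> {y\<in>X n. dist x y \<le> 200 * mesh n}"
      then have y: "y \<in> X n" "dist x y \<le> 200 * mesh n" by auto
      have "dist x y \<le> 256 * mesh n" using y(2) mesh_pos[of n] by linarith
      then show "y \<in> X n \<inter> cball x (2 ^ 8 * mesh n)" using y(1) by simp
    qed
    show "finite {y\<in>X n. dist x y \<le> 200 * mesh n}" using sub fin by (rule finite_subset)
    show "card {y\<in>X n. dist x y \<le> 200 * mesh n} \<le> N ^ 10"
      using card_mono[OF fin sub] card by linarith
  qed
  have countable: "countable (X n)" for n
  proof -
    have "X n \<subseteq> (\<Union>k. X n \<inter> cball base (2 ^ k * mesh n))"
    proof
      fix y assume "y \<in> X n"
      obtain k :: nat where "dist base y / mesh n < 2 ^ k"
        using real_arch_pow[of "2::real"] by auto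
      then have "dist base y \<le> 2 ^ k * mesh n" by (simp add: field_simps)
      then show "y \<in> (\<Union>k. X n \<inter> cball base (2 ^ k * mesh n))"
        using \<open>y \<in> X n\<close> by auto
    qed
    moreover have "countable (\<Union>k. X n \<inter> cball base (2 ^ k * mesh n))"
    proof (intro countable_UN[OF countableI_type] countable_finite)
      show "finite (X n \<inter> cball base (2 ^ k * mesh n))" for k
        using N[OF mesh_pos X(2)] by blast
    qed
    ultimately show ?thesis by (rule countable_subset)
  qed
  have "net_tree X par cen base p (N ^ 10)" if "0 < p" "p * (real (N ^ 10) + 1) \<le> 1" for p
    by unfold_locales (use X par cen near countable that in auto)
  then show ?thesis by blast
qed

context net_tree
begin

section \<open>Lines of ancestors and their geometry\<close>

primrec anc :: "int \<Rightarrow> nat \<Rightarrow> 'a \<Rightarrow> 'a" where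
  "anc n 0 y = y"
| "anc n (Suc k) y = par (n - int (Suc k)) (anc n k y)"

lemma anc_in: "y \<in> X n \<Longrightarrow> anc n k y \<in> X (n - int k)"
proof (induction k)
  case (Suc k)
  then have "anc n k y \<in> X (n - int (Suc k) + 1)" by simp
  from par_in[OF this] show ?case by (simp only: anc.simps)
qed simp

lemma anc_in': "y \<in> X n \<Longrightarrow> anc n k y \<in> X (n - int (Suc k) + 1)"
  using anc_in[of y n k] by simp

lemma anc_Suc_shift: "anc (n + 1) (Suc k) y = anc n k (par n y)"
  by (induction k) (auto simp: algebra_simps)

lemma par_base: "par n base = base"
  using par_near[of base n base] base_in by simp

text \<open>The steps are dominated by a geometric series; the induction closes because
  \<open>2 / 16 + 1 \<le> 2\<close>.\<close>

lemma dist_anc: "y \<in> X n \<Longrightarrow> dist y (anc n k y) \<le> 2 * mesh (n - int k)"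
proof (induction k)
  case (Suc k)
  define S where "S = mesh (n - int (Suc k))"
  have "mesh (n - int k) = S / 16"
    using mesh_add1[of "n - int (Suc k)"] by (simp add: S_def)
  then have "dist y (anc n k y) \<le> 2 * (S / 16)" using Suc by simp
  moreover have "dist (anc n k y) (anc n (Suc k) y) < S"
    using par_dist[OF anc_in'[OF Suc.prems, of k]] by (simp add: S_def)
  moreover have "0 < S" by (simp add: S_def)
  ultimately have "dist y (anc n (Suc k) y) \<le> 2 * S"
    using dist_triangle[of y "anc n (Suc k) y" "anc n k y"] by linarith
  then show ?case by (simp add: S_def)
qed (simp add: less_imp_le)

text \<open>Once the mesh exceeds the distance to \<open>base\<close>, the ancestor is within 3
  meshes of \<open>base\<close>. Half of the next coarser mesh is 8 meshes, so
  \<open>par_near\<close> makes \<open>base\<close> the next ancestor. Hence all nodes belong to one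
  tree.\<close>

lemma anc_eventually_base:
  assumes "y \<in> X n"
  shows "\<exists>k. anc n k y = base"
proof -
  obtain k where k: "dist y base < mesh (n - int k)"
    using mesh_unbounded by blast
  define m where "m = n - int (Suc k)"
  have sc: "mesh m = 16 * mesh (n - int k)"
    using mesh_add1[of m] by (simp add: m_def)
  have "dist (anc n k y) base < mesh m / 2"
    using dist_anc[OF assms, of k] dist_triangle3[of "anc n k y" base y] k
      mesh_pos[of "n - int k"] unfolding sc by linarith
  then have "par m (anc n k y) = base"
    using par_near anc_in'[OF assms, of k] base_in unfolding m_def by blast
  then have "anc n (Suc k) y = base" by (simp add: m_def)
  then show ?thesis by blast
qed

text \<open>Let \<open>S\<close> be the mesh of the central child. This child is within
  \<open>S\<close> of its parent \<open>x\<close>, while a node with another parent is at least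
  \<open>8 * S\<close> away from \<open>x\<close>. Each descendant drifts by at most
  \<open>2 * S\<close> from its ancestor, which leaves 8 - 1 - 2 - 2 = 3.\<close>

lemma central_descendants_far:
  assumes y: "y \<in> X n" and z: "z \<in> X n"
    and central: "anc n k y = cen (n - int (Suc k)) (anc n (Suc k) y)"
    and ne: "anc n (Suc k) y \<noteq> anc n (Suc k) z"
  shows "3 * mesh (n - int k) \<le> dist y z"
proof -
  define m where "m = n - int (Suc k)"
  define x where "x = anc n (Suc k) y"
  define S where "S = mesh (n - int k)"
  have S: "mesh (m + 1) = S" "mesh m = 16 * S"
    using mesh_add1[of m] by (simp_all add: m_def S_def)
  have x: "x \<in> X m" unfolding x_def m_def using y by (rule anc_in)
  have "par m (anc n k z) \<noteq> x" using ne by (simp add: m_def x_def)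
  then have "\<not> dist (anc n k z) x < mesh m / 2"
    using par_near[OF anc_in'[OF z, of k, folded m_def] x] by blast
  then have "8 * S \<le> dist (anc n k z) x" unfolding S by simp
  moreover have "dist x (anc n k y) < S"
    using cen_dist[OF x] central[folded m_def x_def] S(1) by simp
  moreover have "dist y (anc n k y) \<le> 2 * S" "dist z (anc n k z) \<le> 2 * S"
    using dist_anc y z by (auto simp: S_def)
  moreover have "dist (anc n k z) x \<le> dist z (anc n k z) + dist y z + dist y (anc n k y) + dist x (anc n k y)"
    using dist_triangle[of "anc n k z" x z] dist_triangle[of z x y] dist_triangle[of y x "anc n k y"]
      dist_commute[of "anc n k z" z] dist_commute[of z y] dist_commute[of "anc n k y" x] by linarith
  ultimately show ?thesis unfolding S_def by linarith
qed

section \<open>Shares of mass passed to the children\<close>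

definition ch :: "int \<Rightarrow> 'a \<Rightarrow> 'a set" where
  "ch n x = {y\<in>X (n + 1). par n y = x}"

lemma ch_near: "ch n x \<subseteq> {y\<in>X (n + 1). dist x y \<le> 200 * mesh (n + 1)}"
proof
  fix y assume "y \<in> ch n x"
  then have y: "y \<in> X (n + 1)" "dist x y < 16 * mesh (n + 1)"
    using par_dist[of y n] by (auto simp: ch_def mesh_add1 dist_commute)
  moreover have "dist x y \<le> 200 * mesh (n + 1)"
    using y(2) mesh_pos[of "n + 1"] by linarith
  ultimately show "y \<in> {y\<in>X (n + 1). dist x y \<le> 200 * mesh (n + 1)}" by simp
qed

lemma finite_ch: "finite (ch n x)"
  using ch_near finite_near by (rule finite_subset)

lemma card_ch: "card (ch n x) \<le> M"
  using card_mono[OF finite_near ch_near] card_near by (rule le_trans)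

lemma cen_in_ch:
  assumes "x \<in> X n"
  shows "cen n x \<in> ch n x"
proof -
  have "dist (cen n x) x < mesh n / 2"
    using cen_dist[OF assms] mesh_pos[of n] unfolding mesh_add1 dist_commute[of x] by linarith
  then show ?thesis
    using cen_in[OF assms] assms par_near by (simp add: ch_def)
qed

definition wt :: "int \<Rightarrow> 'a \<Rightarrow> real" where
  "wt n y = (if y = cen n (par n y) then 1 - p * (real (card (ch n (par n y))) - 1) else p)"

lemma p_le_1: "p \<le> 1"
proof -
  have "p \<le> p * (real M + 1)" using p_pos by (simp add: algebra_simps)
  then show ?thesis using p_le by simp
qed

text \<open>With \<open>c\<close> children the central share \<open>1 - p * (c - 1)\<close> is at
  least \<open>p\<close> as soon as \<open>p * c \<le> 1\<close>, which follows from
  \<open>c \<le> M\<close> and \<open>p_le\<close>.\<close>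

lemma wt_bounds:
  assumes "y \<in> X (n + 1)"
  shows "p \<le> wt n y" "0 < wt n y" "wt n y \<le> 1"
proof -
  let ?c = "real (card (ch n (par n y)))"
  have "y \<in> ch n (par n y)" using assms by (simp add: ch_def)
  then have "card (ch n (par n y)) \<noteq> 0" using finite_ch by auto
  then have c: "1 \<le> ?c" by simp
  have "p * ?c \<le> p * real M"
    using p_pos card_ch by (intro mult_left_mono) auto
  moreover have "p * real M + p \<le> 1" using p_le by (simp add: algebra_simps)
  ultimately have "p * ?c \<le> 1" using p_pos by linarith
  then have "p \<le> 1 - p * (?c - 1)" by (simp add: right_diff_distrib)
  moreover have "0 \<le> p * (?c - 1)" using p_pos c by simp
  ultimately show "p \<le> wt n y" "wt n y \<le> 1" using p_le_1 by (auto simp: wt_def)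
  then show "0 < wt n y" using p_pos by linarith
qed

lemma sum_wt:
  assumes "x \<in> X n"
  shows "sum (wt n) (ch n x) = 1"
proof -
  have "sum (wt n) (ch n x) = wt n (cen n x) + sum (wt n) (ch n x - {cen n x})"
    using cen_in_ch[OF assms] finite_ch by (rule sum.remove[rotated])
  also have "sum (wt n) (ch n x - {cen n x}) = (\<Sum>y\<in>ch n x - {cen n x}. p)"
    by (intro sum.cong) (auto simp: wt_def ch_def)
  also have "wt n (cen n x) = 1 - p * (real (card (ch n x)) - 1)"
    using cen_in_ch[OF assms] by (simp add: wt_def ch_def)
  also have "(\<Sum>y\<in>ch n x - {cen n x}. p) = p * (real (card (ch n x)) - 1)"
    using card_Suc_Diff1[OF finite_ch cen_in_ch[OF assms]] by simp
  finally show ?thesis by simp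
qed

text \<open>The central child contributes at most 1 and every other child \<open>sqrt p\<close>. For
  small \<open>p\<close> the sum is close to 1, so the moment in \<open>sum_sqrt_mass_desc\<close>
  grows slowly.\<close>

lemma sum_sqrt_wt:
  assumes "x \<in> X n"
  shows "(\<Sum>y\<in>ch n x. sqrt (wt n y)) \<le> 1 + real M * sqrt p"
proof -
  have "sqrt (wt n y) \<le> (if y = cen n x then 1 else 0) + sqrt p" if "y \<in> ch n x" for y
  proof (cases "y = cen n x")
    case True
    have "sqrt (wt n y) \<le> 1" using that wt_bounds(3)[of y n] by (simp add: ch_def)
    then show ?thesis using True p_pos by (simp add: add_increasing2)
  qed (use that in \<open>simp add: ch_def wt_def\<close>)
  then have "(\<Sum>y\<in>ch n x. sqrt (wt n y)) \<le> (\<Sum>y\<in>ch n x. (if y = cen n x then 1 else 0) + sqrt p)"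
    by (rule sum_mono)
  also have "\<dots> \<le> 1 + real (card (ch n x)) * sqrt p"
    using finite_ch by (simp add: sum.distrib)
  also have "\<dots> \<le> 1 + real M * sqrt p"
    using card_ch p_pos by (intro add_left_mono mult_right_mono) auto
  finally show ?thesis .
qed

section \<open>The share of an ancestor's mass that reaches a node\<close>

definition path_wt :: "int \<Rightarrow> nat \<Rightarrow> 'a \<Rightarrow> real" where
  "path_wt n k y = (\<Prod>j<k. wt (n - int (Suc j)) (anc n j y))"

lemma path_wt_bounds:
  assumes "y \<in> X n"
  shows "p ^ k \<le> path_wt n k y" "0 < path_wt n k y" "path_wt n k y \<le> 1"
proof -
  have w: "p \<le> wt (n - int (Suc j)) (anc n j y)" "0 < wt (n - int (Suc j)) (anc n j y)"
    "wt (n - int (Suc j)) (anc n j y) \<le> 1" for j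
    using wt_bounds anc_in'[OF assms] by auto
  have "(\<Prod>j<k. p) \<le> path_wt n k y"
    unfolding path_wt_def using w p_pos by (intro prod_mono) auto
  then show "p ^ k \<le> path_wt n k y" by simp
  show "0 < path_wt n k y" unfolding path_wt_def using w by (intro prod_pos) auto
  show "path_wt n k y \<le> 1" unfolding path_wt_def using w by (intro prod_le_1) (auto intro: less_imp_le)
qed

text \<open>For the first two steps the crude bounds \<open>p ^ k\<close> and 1 suffice and cost
  \<open>p ^ 2\<close>. From the third step on, the nodes \<open>y\<close> and \<open>z\<close> are
  closer than \<open>3 * mesh (n - int k)\<close>, so by \<open>central_descendants_far\<close>
  neither line makes a central step before they merge; both products then gain the same factor
  \<open>p\<close>.\<close>

lemma path_wt_comparable:
  assumes y: "y \<in> X n" and z: "z \<in> X n" and near: "dist y z \<le> 200 * mesh n"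
    and ne: "anc n k y \<noteq> anc n k z"
  shows "p ^ 2 * path_wt n k y \<le> path_wt n k z"
  using ne
proof (induction k)
  case 0
  then show ?case using p_pos p_le_1 by (simp add: path_wt_def power_le_one)
next
  case (Suc k)
  have "anc n k y \<noteq> anc n k z" using Suc.prems by auto
  then have IH: "p ^ 2 * path_wt n k y \<le> path_wt n k z" by (rule Suc.IH)
  show ?case
  proof (cases "k < 2")
    case True
    have "p ^ 2 * path_wt n (Suc k) y \<le> p ^ 2 * 1"
      using path_wt_bounds[OF y] p_pos by (intro mult_left_mono) auto
    also have "\<dots> \<le> p ^ Suc k"
      using True p_pos p_le_1 by (simp add: power_decreasing del: power_Suc)
    also have "\<dots> \<le> path_wt n (Suc k) z"
      using path_wt_bounds[OF z] by blast
    finally show ?thesis .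
  next
    case False
    have "mesh (n - 2) = 256 * mesh n"
      using mesh_add1[of "n - 2"] mesh_add1[of "n - 1"] by simp
    moreover have "mesh (n - 2) \<le> mesh (n - int k)"
      using False by (intro mesh_le) auto
    ultimately have far: "dist y z < 3 * mesh (n - int k)"
      using near mesh_pos[of n] by linarith
    have "wt (n - int (Suc k)) (anc n k y) = p"
      using central_descendants_far[OF y z, of k] far Suc.prems by (force simp: wt_def)
    moreover have "wt (n - int (Suc k)) (anc n k z) = p"
      using central_descendants_far[OF z y, of k] far Suc.prems
      by (force simp: wt_def dist_commute)
    ultimately show ?thesis
      using IH p_pos by (simp add: path_wt_def)
  qed
qed

lemma path_wt_Suc_shift:
  "path_wt (n + 1) (Suc k) y = wt n y * path_wt n k (par n y)"
  unfolding path_wt_def prod.lessThan_Suc_shift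
  by (simp add: anc_Suc_shift del: anc.simps(2)) (simp add: algebra_simps)

section \<open>Masses of the nodes\<close>

text \<open>The mass of \<open>base\<close> at level \<open>n\<close>, normalised to 1 at level 0.
  At most one of the two products is nonempty: positive levels multiply by shares, negative ones
  divide by them.\<close>

definition base_wt :: "int \<Rightarrow> real" where
  "base_wt n = (\<Prod>i\<in>{0..<n}. wt i base) / (\<Prod>i\<in>{n..<0}. wt i base)"

lemma wt_base_pos: "0 < wt n base"
  using wt_bounds base_in by blast

lemma base_wt_pos: "0 < base_wt n"
  unfolding base_wt_def by (intro divide_pos_pos prod_pos) (auto simp: wt_base_pos)

lemma base_wt_add1: "base_wt (n + 1) = wt n base * base_wt n"
proof (cases "n \<ge> 0")
  case True
  then have "{0..<n + 1} = insert n {0..<n}" by auto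
  then show ?thesis using True by (simp add: base_wt_def)
next
  case False
  then have "{n..<0} = insert n {n + 1..<0}" by auto
  then show ?thesis using False wt_base_pos[of n] by (simp add: base_wt_def)
qed

text \<open>There is no top level to start from, so the mass is read off at some ancestor equal to
  \<open>base\<close>; by \<open>mass_eq\<close> any such ancestor gives the same value.\<close>

definition mass :: "int \<Rightarrow> 'a \<Rightarrow> real" where
  "mass n y = (let k = (SOME k. anc n k y = base) in base_wt (n - int k) * path_wt n k y)"

text \<open>Since \<open>base\<close> is its own parent, climbing further multiplies
  \<open>path_wt\<close> by exactly the factor by which \<open>base_wt\<close> drops. Two admissible
  heights \<open>k\<close> and \<open>l\<close> are compared at \<open>k + l\<close>.\<close>

lemma mass_eq:
  assumes "anc n k y = base"
  shows "mass n y = base_wt (n - int k) * path_wt n k y"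
proof -
  have step: "anc n (k + i) y = base \<and>
    base_wt (n - int (k + i)) * path_wt n (k + i) y = base_wt (n - int k) * path_wt n k y"
    if "anc n k y = base" for k i
  proof (induction i)
    case (Suc i)
    have "n - int (k + i) = n - int (Suc (k + i)) + 1" by simp
    then have "base_wt (n - int (k + i)) = wt (n - int (Suc (k + i))) base * base_wt (n - int (Suc (k + i)))"
      using base_wt_add1[of "n - int (Suc (k + i))"] by (simp only:)
    then show ?case using Suc by (simp add: par_base path_wt_def mult_ac)
  qed (use that in simp)
  define l where "l = (SOME k. anc n k y = base)"
  have l: "anc n l y = base" unfolding l_def using assms by (rule someI)
  have "base_wt (n - int l) * path_wt n l y = base_wt (n - int k) * path_wt n k y"
    using step[OF assms, of l] step[OF l, of k] by (simp add: add.commute)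
  then show ?thesis by (simp add: mass_def l_def)
qed

lemma mass_pos: "y \<in> X n \<Longrightarrow> 0 < mass n y"
  using anc_eventually_base[of y n] mass_eq base_wt_pos path_wt_bounds by fastforce

lemma mass_add1:
  assumes "y \<in> X (n + 1)"
  shows "mass (n + 1) y = wt n y * mass n (par n y)"
proof -
  obtain k where k: "anc n k (par n y) = base"
    using anc_eventually_base[OF par_in[OF assms]] by auto
  then have "anc (n + 1) (Suc k) y = base"
    by (simp only: anc_Suc_shift)
  then show ?thesis
    using mass_eq[OF k] mass_eq[of "n + 1" "Suc k" y] by (simp add: path_wt_Suc_shift)
qed

lemma mass_anc:
  assumes "y \<in> X n"
  shows "mass n y = mass (n - int k) (anc n k y) * path_wt n k y"
proof (induction k)
  case (Suc k)
  then show ?case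
    using mass_add1[OF anc_in'[OF assms, of k]] by (simp add: path_wt_def)
qed (simp add: path_wt_def)

lemma mass_ch:
  assumes "x \<in> X n"
  shows "sum (mass (n + 1)) (ch n x) = mass n x"
proof -
  have "sum (mass (n + 1)) (ch n x) = (\<Sum>y\<in>ch n x. wt n y * mass n x)"
    by (intro sum.cong) (auto simp: ch_def mass_add1)
  then show ?thesis using sum_wt[OF assms] by (simp flip: sum_distrib_right)
qed

text \<open>Below the level where the lines of ancestors of two nearby net points merge,
  both lines are close to each other but run through different parents, so no
  step is central and each costs the same factor \<^term>\<open>p\<close>. Only the
  first two levels and the merging level can differ.\<close>

lemma mass_comparable:
  assumes y: "y \<in> X n" and z: "z \<in> X n" and near: "dist y z \<le> 200 * mesh n"
  shows "mass n y \<le> mass n z / p ^ 3"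
proof -
  obtain k l where kl: "anc n k y = base" "anc n l z = base"
    using anc_eventually_base y z by metis
  have base_add: "anc n (k + i) x = base" if "anc n k x = base" for k i x
    by (induction i) (use that par_base in auto)
  \<comment> \<open>Both lines have reached \<open>base\<close> after \<open>k + l\<close> steps;
    below, \<open>m\<close> is the first step at which they agree.\<close>
  have "anc n (k + l) y = anc n (k + l) z"
    using base_add[OF kl(1), of l] base_add[OF kl(2), of k] by (simp add: add.commute)
  then obtain m where m: "anc n m y = anc n m z" "\<And>i. i < m \<Longrightarrow> anc n i y \<noteq> anc n i z"
    using exists_least_iff[of "\<lambda>m. anc n m y = anc n m z"] by auto
  have "p ^ 3 * path_wt n m y \<le> path_wt n m z"
  proof (cases m)
    case 0
    then show ?thesis using p_pos p_le_1 by (simp add: path_wt_def power_le_one)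
  next
    case (Suc i)
    have "p ^ 3 * path_wt n m y = p * (p ^ 2 * path_wt n i y) * wt (n - int m) (anc n i y)"
      by (simp add: Suc path_wt_def power3_eq_cube power2_eq_square)
    also have "\<dots> \<le> p * (p ^ 2 * path_wt n i y) * 1"
      using wt_bounds(3)[OF anc_in'[OF y, of i]] path_wt_bounds[OF y, of i] p_pos
      by (intro mult_left_mono) (auto simp: Suc)
    also have "\<dots> \<le> p * path_wt n i z"
      using path_wt_comparable[OF y z near m(2), of i] p_pos by (simp add: Suc)
    also have "\<dots> \<le> wt (n - int m) (anc n i z) * path_wt n i z"
      using wt_bounds(1)[OF anc_in'[OF z, of i]] path_wt_bounds[OF z, of i]
      by (intro mult_right_mono) (auto simp: Suc)
    also have "\<dots> = path_wt n m z"
      by (simp add: Suc path_wt_def)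
    finally show ?thesis .
  qed
  then have "mass (n - int m) (anc n m y) * (p ^ 3 * path_wt n m y)
      \<le> mass (n - int m) (anc n m z) * path_wt n m z"
    using m(1) mass_pos[OF anc_in[OF z, of m]] by simp
  then have "p ^ 3 * mass n y \<le> mass n z"
    using mass_anc[OF y, of m] mass_anc[OF z, of m] by (simp add: mult_ac)
  then show ?thesis using p_pos by (simp add: field_simps)
qed


subsection \<open>Coding points by Lebesgue measure\<close>

definition split_at :: "int \<Rightarrow> 'a \<Rightarrow> real \<Rightarrow> 'a \<Rightarrow> real" where
  "split_at n x l = (SOME g.
     {l..<l + mass n x} = (\<Union>y\<in>ch n x. {g y..<g y + mass (n + 1) y}) \<and>
     disjoint_family_on (\<lambda>y. {g y..<g y + mass (n + 1) y}) (ch n x))"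

text \<open>The choice in \<open>split_at\<close> depends only on the parent and its left end, so
  all siblings read their positions from the same subdivision.\<close>

primrec left :: "nat \<Rightarrow> 'a \<Rightarrow> real" where
  "left 0 = (SOME g. disjoint_family_on (\<lambda>y. {g y..<g y + mass 0 y}) (X 0))"
| "left (Suc m) = (\<lambda>y. split_at (int m) (par (int m) y) (left m (par (int m) y)) y)"

definition cell :: "nat \<Rightarrow> 'a \<Rightarrow> real set" where
  "cell m y = {left m y..<left m y + mass (int m) y}"

lemma cell_split:
  assumes "x \<in> X (int m)"
  shows "cell m x = (\<Union>y\<in>ch (int m) x. cell (Suc m) y)"
    and "disjoint_family_on (cell (Suc m)) (ch (int m) x)"
proof -
  let ?g = "split_at (int m) x (left m x)"
  have nonneg: "0 \<le> mass (int m + 1) y" if "y \<in> ch (int m) x" for y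
    using that mass_pos[of y "int m + 1"] by (simp add: ch_def)
  have "\<exists>g. {left m x..<left m x + mass (int m) x}
        = (\<Union>y\<in>ch (int m) x. {g y..<g y + mass (int m + 1) y}) \<and>
      disjoint_family_on (\<lambda>y. {g y..<g y + mass (int m + 1) y}) (ch (int m) x)"
    using interval_split_finite[where S = "ch (int m) x" and W = "mass (int m + 1)" and l = "left m x",
        OF finite_ch nonneg]
    unfolding mass_ch[OF assms] .
  from someI_ex[OF this] have g: "{left m x..<left m x + mass (int m) x}
        = (\<Union>y\<in>ch (int m) x. {?g y..<?g y + mass (int m + 1) y})"
      "disjoint_family_on (\<lambda>y. {?g y..<?g y + mass (int m + 1) y}) (ch (int m) x)"
    unfolding split_at_def by blast+
  have eq: "cell (Suc m) y = {?g y..<?g y + mass (int m + 1) y}" if "y \<in> ch (int m) x" for y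
    using that by (simp add: cell_def ch_def add.commute)
  show "cell m x = (\<Union>y\<in>ch (int m) x. cell (Suc m) y)"
    using g(1) eq by (simp add: cell_def[of m])
  show "disjoint_family_on (cell (Suc m)) (ch (int m) x)"
    using g(2) eq unfolding disjoint_family_on_def by simp
qed

lemma in_ch_par: "y \<in> X (n + 1) \<Longrightarrow> y \<in> ch n (par n y)"
  by (simp add: ch_def)

lemma cell_disjoint: "disjoint_family_on (cell m) (X (int m))"
proof (induction m)
  case 0
  have "\<exists>g. disjoint_family_on (\<lambda>y. {g y..<g y + mass 0 y}) (X 0)"
    using countable_X mass_pos by (intro disjoint_intervals_countable) (auto intro: less_imp_le)
  from someI_ex[OF this] show ?case by (simp add: cell_def[abs_def])
next
  case (Suc m)
  have "cell (Suc m) y \<inter> cell (Suc m) z = {}"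
    if yz: "y \<in> X (int m + 1)" "z \<in> X (int m + 1)" "y \<noteq> z" for y z
  proof (cases "par (int m) y = par (int m) z")
    case True
    then show ?thesis
      using cell_split(2)[OF par_in[OF yz(1)]] in_ch_par[OF yz(1)] in_ch_par[OF yz(2)] yz(3)
      unfolding disjoint_family_on_def by simp
  next
    case False
    have "cell (Suc m) y \<subseteq> cell m (par (int m) y)" "cell (Suc m) z \<subseteq> cell m (par (int m) z)"
      using cell_split(1)[OF par_in] in_ch_par yz by blast+
    moreover have "cell m (par (int m) y) \<inter> cell m (par (int m) z) = {}"
      using Suc False par_in yz unfolding disjoint_family_on_def by simp
    ultimately show ?thesis by blast
  qed
  then show ?case by (simp add: disjoint_family_on_def add.commute)
qed

definition dom :: "real set" where
  "dom = (\<Union>x\<in>X 0. cell 0 x)"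

lemma dom_eq: "dom = (\<Union>y\<in>X (int m). cell m y)"
proof (induction m)
  case (Suc m)
  have "(\<Union>y\<in>X (int m). cell m y) = (\<Union>x\<in>X (int m). \<Union>y\<in>ch (int m) x. cell (Suc m) y)"
    using cell_split(1) by simp
  also have "\<dots> = (\<Union>y\<in>X (int m + 1). cell (Suc m) y)"
    using par_in by (auto simp: ch_def)
  finally show ?case using Suc by (simp add: add.commute)
qed (simp add: dom_def)

section \<open>The line of nodes coded by a real number\<close>

definition code :: "nat \<Rightarrow> real \<Rightarrow> 'a" where
  "code m t = (THE y. y \<in> X (int m) \<and> t \<in> cell m y)"

lemma code_eq:
  assumes "y \<in> X (int m)" "t \<in> cell m y"
  shows "code m t = y"
  unfolding code_def
  using assms cell_disjoint[of m] by (intro the_equality) (auto simp: disjoint_family_on_def)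

lemma code_in:
  assumes "t \<in> dom"
  shows "code m t \<in> X (int m)" "t \<in> cell m (code m t)"
proof -
  obtain y where "y \<in> X (int m)" "t \<in> cell m y"
    using assms dom_eq[of m] by blast
  then show "code m t \<in> X (int m)" "t \<in> cell m (code m t)"
    using code_eq by auto
qed

lemma par_code:
  assumes "t \<in> dom"
  shows "par (int m) (code (Suc m) t) = code m t"
proof -
  have c: "code (Suc m) t \<in> X (int m + 1)"
    using code_in(1)[OF assms, of "Suc m"] by (simp add: add.commute)
  have "cell (Suc m) (code (Suc m) t) \<subseteq> cell m (par (int m) (code (Suc m) t))"
    using cell_split(1)[OF par_in[OF c]] in_ch_par[OF c] by blast
  then show ?thesis
    using code_eq[OF par_in[OF c]] code_in(2)[OF assms, of "Suc m"] by auto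
qed

text \<open>Intervals exist for nonnegative levels only; ancestors extend the coding to coarse
  levels, which the doubling estimate needs for large radii.\<close>

definition node :: "int \<Rightarrow> real \<Rightarrow> 'a" where
  "node n t = (if 0 \<le> n then code (nat n) t else anc 0 (nat (- n)) (code 0 t))"

lemma node_in: "t \<in> dom \<Longrightarrow> node n t \<in> X n"
  using code_in(1)[of t "nat n"] anc_in[OF code_in(1)[of t 0], of "nat (- n)"]
  by (cases "0 \<le> n") (simp_all add: node_def)

lemma par_node:
  assumes t: "t \<in> dom"
  shows "par n (node (n + 1) t) = node n t"
proof (cases "0 \<le> n")
  case True
  then have "nat (n + 1) = Suc (nat n)" by simp
  then show ?thesis
    using par_code[OF t, of "nat n"] True by (simp add: node_def)
next
  case False
  define k where "k = nat (- n - 1)"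
  have k: "n = - int (Suc k)" using False by (simp add: k_def)
  have "node (n + 1) t = anc 0 k (code 0 t)"
    using False by (cases "n = - 1") (auto simp: node_def k_def)
  moreover have "nat (- n) = Suc k" using False by (simp add: k_def)
  ultimately show ?thesis
    using False by (simp add: node_def) (simp add: k)
qed

lemma anc_node: "t \<in> dom \<Longrightarrow> anc n k (node n t) = node (n - int k) t"
proof (induction k)
  case (Suc k)
  then show ?case using par_node[of t "n - int (Suc k)"] by simp
qed simp

lemma dist_node: "t \<in> dom \<Longrightarrow> m \<le> n \<Longrightarrow> dist (node n t) (node m t) \<le> 2 * mesh m"
  using dist_anc[OF node_in, of t n "nat (n - m)"] anc_node[of t n "nat (n - m)"] by simp

text \<open>At nonnegative levels the set is a cell. At negative levels it is the disjoint union of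
  the sets of the children, and masses add up by \<open>mass_ch\<close>.\<close>

lemma node_set:
  assumes "y \<in> X n"
  shows "{t\<in>dom. node n t = y} \<in> sets borel \<and>
    emeasure lborel {t\<in>dom. node n t = y} = ennreal (mass n y)"
proof (cases "0 \<le> n")
  case True
  then have y: "y \<in> X (int (nat n))" using assms by simp
  have "{t\<in>dom. node n t = y} = cell (nat n) y"
    using True y code_eq[OF y] code_in(2)[of _ "nat n"] dom_eq[of "nat n"]
    by (auto simp: node_def)
  moreover have "emeasure lborel (cell (nat n) y) = ennreal (mass n y)"
    using True mass_pos[OF assms] by (simp add: cell_def)
  moreover have "cell (nat n) y \<in> sets borel" by (simp add: cell_def)
  ultimately show ?thesis by simp
next
  case False
  have "\<forall>y\<in>X (- int k). {t\<in>dom. node (- int k) t = y} \<in> sets borel \<and>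
    emeasure lborel {t\<in>dom. node (- int k) t = y} = ennreal (mass (- int k) y)" for k
  proof (induction k)
    case 0
    have "{t\<in>dom. node 0 t = y} = cell 0 y" if "y \<in> X 0" for y
      using that code_eq[of y 0] code_in(2)[of _ 0] dom_eq[of 0] by (auto simp: node_def)
    then show ?case using mass_pos[of _ 0] by (auto simp: cell_def less_imp_le)
  next
    case (Suc k)
    show ?case
    proof
      fix x assume x: "x \<in> X (- int (Suc k))"
      define n where "n = - int (Suc k)"
      have n1: "- int k = n + 1" by (simp add: n_def)
      have x: "x \<in> X n" using x by (simp add: n_def)
      let ?E = "\<lambda>y. {t\<in>dom. node (n + 1) t = y}"
      have IH: "?E y \<in> sets borel \<and> emeasure lborel (?E y) = ennreal (mass (n + 1) y)"
        if "y \<in> ch n x" for y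
        using Suc that by (simp add: n1 ch_def)
      have eq: "{t\<in>dom. node n t = x} = (\<Union>y\<in>ch n x. ?E y)"
        using par_node[of _ n] node_in[of _ "n + 1"] by (auto simp: ch_def)
      have "emeasure lborel (\<Union>y\<in>ch n x. ?E y) = (\<Sum>y\<in>ch n x. emeasure lborel (?E y))"
        using IH finite_ch by (intro sum_emeasure[symmetric]) (auto simp: disjoint_family_on_def)
      also have "\<dots> = (\<Sum>y\<in>ch n x. ennreal (mass (n + 1) y))"
        using IH by (intro sum.cong) auto
      also have "\<dots> = ennreal (mass n x)"
        using mass_ch[OF x] mass_pos[of _ "n + 1"]
        by (subst sum_ennreal) (auto simp: ch_def less_imp_le)
      finally have "emeasure lborel {t\<in>dom. node n t = x} = ennreal (mass n x)"
        by (simp add: eq)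
      moreover have "{t\<in>dom. node n t = x} \<in> sets borel"
        unfolding eq using IH finite_ch by (intro sets.finite_UN) auto
      ultimately show "{t\<in>dom. node (- int (Suc k)) t = x} \<in> sets borel \<and>
        emeasure lborel {t\<in>dom. node (- int (Suc k)) t = x} = ennreal (mass (- int (Suc k)) x)"
        by (simp only: n_def)
    qed
  qed
  from this[of "nat (- n)"] show ?thesis using False assms by simp
qed

lemma dom_borel [measurable]: "dom \<in> sets borel"
  unfolding dom_def using countable_X by (intro sets.countable_UN') (auto simp: cell_def)

definition code_space :: "real measure" where
  "code_space = restrict_space lborel dom"

lemma space_code_space [simp]: "space code_space = dom"
  by (simp add: code_space_def)

lemma sets_code_space: "A \<subseteq> dom \<Longrightarrow> A \<in> sets borel \<Longrightarrow> A \<in> sets code_space"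
  by (auto simp: code_space_def sets_restrict_space)

lemma node_event:
  assumes "y \<in> X n"
  shows "{t\<in>dom. node n t = y} \<in> sets code_space"
    and "emeasure code_space {t\<in>dom. node n t = y} = ennreal (mass n y)"
proof -
  let ?E = "{t\<in>dom. node n t = y}"
  have E: "?E \<subseteq> dom" "?E \<in> sets borel" using node_set[OF assms] by auto
  then show "?E \<in> sets code_space" by (rule sets_code_space)
  have "emeasure code_space ?E = emeasure lborel ?E"
    unfolding code_space_def using E(1) by (intro emeasure_restrict_space) simp_all
  then show "emeasure code_space ?E = ennreal (mass n y)"
    using node_set[OF assms] by simp
qed

text \<open>The nodes of one level form a countable set, so no regularity of \<open>A\<close> is
  required.\<close>

lemma node_event_sets: "{t\<in>dom. node n t \<in> A} \<in> sets code_space"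
proof -
  have "{t\<in>dom. node n t \<in> A} = (\<Union>y\<in>X n \<inter> A. {t\<in>dom. node n t = y})"
    using node_in by auto
  moreover have "countable (X n \<inter> A)" using countable_X by auto
  ultimately show ?thesis
    using node_event(1) by (simp only:, intro sets.countable_UN') blast+
qed

lemma emeasure_node_finite:
  assumes "finite A" "A \<subseteq> X n"
  shows "emeasure code_space {t\<in>dom. node n t \<in> A} = ennreal (sum (mass n) A)"
proof -
  have "{t\<in>dom. node n t \<in> A} = (\<Union>y\<in>A. {t\<in>dom. node n t = y})" by auto
  then have "emeasure code_space {t\<in>dom. node n t \<in> A} = (\<Sum>y\<in>A. emeasure code_space {t\<in>dom. node n t = y})"
    using assms node_event(1)
    by (simp only:, intro sum_emeasure[symmetric]) (auto simp: disjoint_family_on_def)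
  also have "\<dots> = (\<Sum>y\<in>A. ennreal (mass n y))"
    using assms node_event(2) by (intro sum.cong) auto
  also have "\<dots> = ennreal (sum (mass n) A)"
    using assms mass_pos by (intro sum_ennreal) (auto intro: less_imp_le)
  finally show ?thesis .
qed

section \<open>Convergence of the nodes to a point of the space\<close>

definition point :: "real \<Rightarrow> 'a" where
  "point t = lim (\<lambda>m. node (int m) t)"

lemma node_tendsto_point:
  assumes t: "t \<in> dom"
  shows "(\<lambda>m. node (int m) t) \<longlonglongrightarrow> point t"
proof -
  have "Cauchy (\<lambda>m. node (int m) t)"
  proof (rule metric_CauchyI)
    fix e :: real assume "e > 0"
    then have "\<forall>\<^sub>F m in sequentially. mesh (int m) < e / 4"
      using order_tendstoD(2)[OF mesh_tendsto_0, of "e / 4"] by simp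
    then obtain k where k: "mesh (int k) < e / 4"
      by (auto simp: eventually_sequentially)
    have "dist (node (int m) t) (node (int n) t) < e" if "k \<le> m" "k \<le> n" for m n
      using dist_node[OF t, of "int k" "int m"] dist_node[OF t, of "int k" "int n"] that k
        dist_triangle2[of "node (int m) t" "node (int n) t" "node (int k) t"] by simp
    then show "\<exists>M. \<forall>m\<ge>M. \<forall>n\<ge>M. dist (node (int m) t) (node (int n) t) < e" by blast
  qed
  then show ?thesis
    unfolding point_def by (intro convergent_LIMSEQ_iff[THEN iffD1] Cauchy_convergent)
qed

lemma dist_point_node:
  assumes t: "t \<in> dom"
  shows "dist (point t) (node n t) \<le> 2 * mesh n"
proof (rule tendsto_upperbound)
  show "((\<lambda>m. dist (node (int m) t) (node n t)) \<longlongrightarrow> dist (point t) (node n t)) sequentially"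
    by (intro tendsto_dist node_tendsto_point[OF t] tendsto_const)
  show "\<forall>\<^sub>F m in sequentially. dist (node (int m) t) (node n t) \<le> 2 * mesh n"
    using eventually_ge_at_top[of "nat n"] by eventually_elim (auto intro: dist_node[OF t])
qed simp

lemma measurable_node: "node n \<in> borel_measurable code_space"
proof (rule measurableI)
  fix A
  have "node n -` A \<inter> space code_space = {t\<in>dom. node n t \<in> A}" by auto
  then show "node n -` A \<inter> space code_space \<in> sets code_space"
    using node_event_sets by simp
qed simp

lemma measurable_point [measurable]: "point \<in> borel_measurable code_space"
  by (rule borel_measurable_LIMSEQ_metric[of "\<lambda>m. node (int m)"])
    (auto intro: measurable_node node_tendsto_point)

subsection \<open>The doubling measure\<close>

definition \<nu> :: "'a measure" where
  "\<nu> = distr code_space borel point"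

lemma sets_\<nu> [simp]: "sets \<nu> = sets borel"
  by (simp add: \<nu>_def)

lemma emeasure_\<nu>: "B \<in> sets borel \<Longrightarrow> emeasure \<nu> B = emeasure code_space {t\<in>dom. point t \<in> B}"
  unfolding \<nu>_def by (subst emeasure_distr) (auto intro: arg_cong[where f="emeasure code_space"])

lemma point_sets: "B \<in> sets borel \<Longrightarrow> {t\<in>dom. point t \<in> B} \<in> sets code_space"
  using measurable_sets[OF measurable_point, of B] by (simp add: vimage_def Int_def conj_commute)

text \<open>By \<open>dist_point_node\<close>, all mass passing through \<open>z\<close> ends up
  within two meshes of \<open>z\<close>.\<close>

lemma mass_le_\<nu>:
  assumes "z \<in> X n" "cball z (2 * mesh n) \<subseteq> B" "B \<in> sets borel"
  shows "ennreal (mass n z) \<le> emeasure \<nu> B"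
proof -
  have "{t\<in>dom. node n t = z} \<subseteq> {t\<in>dom. point t \<in> B}"
    using assms(2) dist_point_node[of _ n] by (auto simp: dist_commute subset_iff)
  then have "emeasure code_space {t\<in>dom. node n t = z} \<le> emeasure code_space {t\<in>dom. point t \<in> B}"
    using point_sets[OF assms(3)] by (rule emeasure_mono)
  then show ?thesis
    using node_event(2)[OF assms(1)] emeasure_\<nu>[OF assms(3)] by simp
qed

text \<open>Conversely, mass that ends up in \<open>B\<close> has passed through a node within two
  meshes of \<open>B\<close>.\<close>

lemma \<nu>_le_mass:
  assumes "finite A" "A \<subseteq> X n" "B \<in> sets borel"
    and near: "\<And>b y. b \<in> B \<Longrightarrow> y \<in> X n \<Longrightarrow> dist b y \<le> 2 * mesh n \<Longrightarrow> y \<in> A"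
  shows "emeasure \<nu> B \<le> ennreal (sum (mass n) A)"
proof -
  have "{t\<in>dom. point t \<in> B} \<subseteq> {t\<in>dom. node n t \<in> A}"
    using near dist_point_node[of _ n] node_in[of _ n] by auto
  then have "emeasure code_space {t\<in>dom. point t \<in> B} \<le> emeasure code_space {t\<in>dom. node n t \<in> A}"
    using node_event_sets by (rule emeasure_mono)
  then show ?thesis
    using emeasure_node_finite[OF assms(1,2)] emeasure_\<nu>[OF assms(3)] by simp
qed

text \<open>At a level with mesh comparable to \<open>r\<close>, a single node \<open>z\<close>
  already puts its mass into the small ball, and at most \<open>M\<close> nodes feed the large one;
  their masses are comparable to that of \<open>z\<close>.\<close>

lemma \<nu>_cball_doubling:
  assumes "0 < r"
  shows "0 < emeasure \<nu> (cball x r)"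
    and "emeasure \<nu> (cball x r) < \<infinity>"
    and "emeasure \<nu> (cball x (2 * r)) \<le> ennreal (real M / p ^ 3) * emeasure \<nu> (cball x r)"
proof -
  \<comment> \<open>The quotient \<open>r / 4\<close> makes room for the 3 meshes between
    \<open>x\<close> and the mass of \<open>z\<close>, while \<open>r\<close> stays below 64
    meshes.\<close>
  obtain n where n: "mesh n \<le> r / 4" "r / 4 < 16 * mesh n"
    using mesh_between[of "r / 4"] assms by auto
  obtain z where z: "z \<in> X n" "dist x z < mesh n"
    using dense by blast
  define A where "A = {y\<in>X n. dist z y \<le> 200 * mesh n}"
  have A: "finite A" "A \<subseteq> X n" "card A \<le> M"
    using finite_near card_near by (auto simp: A_def)
  have low: "ennreal (mass n z) \<le> emeasure \<nu> (cball x r)"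
  proof (rule mass_le_\<nu>[OF z(1)])
    show "cball z (2 * mesh n) \<subseteq> cball x r"
    proof
      fix y assume "y \<in> cball z (2 * mesh n)"
      then show "y \<in> cball x r"
        using z(2) n(1) assms dist_triangle[of x y z] by simp
    qed
  qed simp
  have "emeasure \<nu> (cball x (2 * r)) \<le> ennreal (sum (mass n) A)"
  proof (rule \<nu>_le_mass[OF A(1,2)])
    fix b y assume b: "b \<in> cball x (2 * r)" "y \<in> X n" "dist b y \<le> 2 * mesh n"
    have "dist z y \<le> dist x z + dist x b + dist b y"
      using dist_triangle[of z y x] dist_triangle[of x y b] by (simp add: dist_commute)
    moreover have "dist x b \<le> 2 * r" using b(1) by simp
    \<comment> \<open>In meshes: 1 for \<open>z\<close>, below 128 for \<open>2 * r\<close> and 2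
      for \<open>y\<close>, at most 131 in total.\<close>
    ultimately have "dist z y \<le> 200 * mesh n"
      using b(3) z(2) n(2) mesh_pos[of n] by linarith
    then show "y \<in> A"
      using b(2) by (simp add: A_def)
  qed simp
  also have "sum (mass n) A \<le> real (card A) * (mass n z / p ^ 3)"
    using mass_comparable[OF _ z(1)] by (intro sum_bounded_above) (auto simp: A_def dist_commute)
  also have "\<dots> \<le> real M * (mass n z / p ^ 3)"
    using A(3) mass_pos[OF z(1)] p_pos by (intro mult_right_mono) auto
  also have "\<dots> = real M / p ^ 3 * mass n z" by simp
  finally have up: "emeasure \<nu> (cball x (2 * r)) \<le> ennreal (real M / p ^ 3 * mass n z)"
    by (auto intro: ennreal_leI)
  show "0 < emeasure \<nu> (cball x r)"
    using low mass_pos[OF z(1)] by (metis ennreal_less_zero_iff less_le_trans)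
  have "emeasure \<nu> (cball x r) \<le> emeasure \<nu> (cball x (2 * r))"
    using assms by (intro emeasure_mono) (auto intro!: subset_cball)
  then show "emeasure \<nu> (cball x r) < \<infinity>"
    using up by (metis ennreal_less_top infinity_ennreal_def le_less_trans)
  have "ennreal (real M / p ^ 3 * mass n z) \<le> ennreal (real M / p ^ 3) * emeasure \<nu> (cball x r)"
    using low p_pos mass_pos[OF z(1)] by (subst ennreal_mult) (auto intro!: mult_left_mono)
  then show "emeasure \<nu> (cball x (2 * r)) \<le> ennreal (real M / p ^ 3) * emeasure \<nu> (cball x r)"
    using up by (rule order_trans[rotated])
qed

lemma doubling_measure_\<nu>: "doubling_measure (outer_measure_of \<nu>)"
  unfolding doubling_measure_def
proof (intro conjI exI allI impI)
  show "borel_regular_outer_measure (outer_measure_of \<nu>)"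
    by (rule borel_regular_outer_measure_of) simp
  show "1 \<le> max 1 (real M / p ^ 3)" by simp
  fix x :: 'a and r :: real assume r: "0 < r"
  show "0 < outer_measure_of \<nu> (cball x (2 * r))"
    using \<nu>_cball_doubling(1)[of "2 * r" x] r by simp
  have "emeasure \<nu> (cball x (2 * r)) \<le> ennreal (real M / p ^ 3) * emeasure \<nu> (cball x r)"
    using r by (rule \<nu>_cball_doubling)
  also have "\<dots> \<le> ennreal (max 1 (real M / p ^ 3)) * emeasure \<nu> (cball x r)"
    by (intro mult_right_mono ennreal_leI) auto
  finally show "outer_measure_of \<nu> (cball x (2 * r))
      \<le> ennreal (max 1 (real M / p ^ 3)) * outer_measure_of \<nu> (cball x r)" by simp
  show "ennreal (max 1 (real M / p ^ 3)) * outer_measure_of \<nu> (cball x r) < \<infinity>"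
    using \<nu>_cball_doubling(2)[OF r, of x] by (simp add: ennreal_mult_less_top)
qed


subsection \<open>Lower mass bounds\<close>

text \<open>Restricting to the descendants of one node of level 0 keeps all sums finite.\<close>

primrec desc :: "'a \<Rightarrow> nat \<Rightarrow> 'a set" where
  "desc x 0 = {x}"
| "desc x (Suc m) = (\<Union>y\<in>desc x m. ch (int m) y)"

lemma desc_subset: "x \<in> X 0 \<Longrightarrow> desc x m \<subseteq> X (int m)"
  by (cases m) (auto simp: ch_def add.commute)

lemma finite_desc: "finite (desc x m)"
  by (induction m) (auto simp: finite_ch)

lemma node_in_desc: "t \<in> dom \<Longrightarrow> node (int m) t \<in> desc (node 0 t) m"
proof (induction m)
  case (Suc m)
  then have "node (int m + 1) t \<in> ch (int m) (node (int m) t)"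
    using par_node[of t "int m"] node_in[of t "int m + 1"] by (simp add: ch_def)
  then show ?case using Suc by (auto simp: add.commute)
qed simp

text \<open>As \<open>sqrt m = m * m powr (-1/2)\<close>, the left side integrates the power -1/2 of
  the node mass over the codes below \<open>x\<close>. By \<open>sum_sqrt_wt\<close> each generation
  costs at most one factor \<open>1 + real M * sqrt p\<close>.\<close>

lemma sum_sqrt_mass_desc:
  assumes "x \<in> X 0"
  shows "(\<Sum>y\<in>desc x m. sqrt (mass (int m) y)) \<le> (1 + real M * sqrt p) ^ m * sqrt (mass 0 x)"
proof (induction m)
  case (Suc m)
  have "(\<Sum>y\<in>desc x (Suc m). sqrt (mass (int (Suc m)) y))
      = (\<Sum>y\<in>desc x m. \<Sum>z\<in>ch (int m) y. sqrt (mass (int m + 1) z))"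
    by (simp add: add.commute, rule sum.UNION_disjoint)
      (auto simp: finite_desc finite_ch, auto simp: ch_def)
  also have "\<dots> = (\<Sum>y\<in>desc x m. (\<Sum>z\<in>ch (int m) y. sqrt (wt (int m) z)) * sqrt (mass (int m) y))"
    unfolding sum_distrib_right
    by (intro sum.cong refl) (auto simp: ch_def mass_add1 real_sqrt_mult)
  also have "\<dots> \<le> (\<Sum>y\<in>desc x m. (1 + real M * sqrt p) * sqrt (mass (int m) y))"
  proof (intro sum_mono mult_right_mono)
    fix y assume "y \<in> desc x m"
    then have y: "y \<in> X (int m)" using desc_subset[OF assms] by blast
    show "(\<Sum>z\<in>ch (int m) y. sqrt (wt (int m) z)) \<le> 1 + real M * sqrt p"
      by (rule sum_sqrt_wt[OF y])
    show "0 \<le> sqrt (mass (int m) y)" using mass_pos[OF y] by simp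
  qed
  also have "\<dots> = (1 + real M * sqrt p) * (\<Sum>y\<in>desc x m. sqrt (mass (int m) y))"
    by (simp add: sum_distrib_left)
  also have "\<dots> \<le> (1 + real M * sqrt p) * ((1 + real M * sqrt p) ^ m * sqrt (mass 0 x))"
    using Suc p_pos by (intro mult_left_mono) auto
  finally show ?case by simp
qed simp

text \<open>Markov's inequality for the \<open>-1/2\<close>-th moment of the mass of the random
  net point, followed by the Borel--Cantelli lemma.\<close>

lemma AE_mass_node_ge:
  assumes a: "0 < a" and small: "sqrt a * (1 + real M * sqrt p) < 1"
  shows "AE t in code_space. \<forall>\<^sub>F m in sequentially. a ^ m \<le> mass (int m) (node (int m) t)"
proof -
  define b where "b = sqrt a * (1 + real M * sqrt p)"
  have b: "0 \<le> b" "b < 1" using a p_pos small by (auto simp: b_def)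
  \<comment> \<open>The total measure may be infinite, so the estimate is made below one node
    \<open>x\<close> of level 0; there are only countably many of them.\<close>
  have "AE t in code_space. node 0 t = x \<longrightarrow>
      (\<forall>\<^sub>F m in sequentially. a ^ m \<le> mass (int m) (node (int m) t))" if x: "x \<in> X 0" for x
  proof -
    define A where "A m = {y\<in>desc x m. mass (int m) y < a ^ m}" for m
    let ?E = "\<lambda>m. {t\<in>dom. node (int m) t \<in> A m}"
    have A: "finite (A m)" "A m \<subseteq> X (int m)" for m
      using finite_desc desc_subset[OF x] by (auto simp: A_def)
    have sum_le: "sum (mass (int m)) (A m) \<le> sqrt (mass 0 x) * b ^ m" for m
    proof -
      \<comment> \<open>On \<open>A m\<close> the mass is below \<open>a ^ m\<close>, so one of its
        two square root factors may be replaced by \<open>sqrt (a ^ m)\<close>.\<close>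
      have "sum (mass (int m)) (A m) \<le> (\<Sum>y\<in>A m. sqrt (a ^ m) * sqrt (mass (int m) y))"
      proof (intro sum_mono)
        fix y assume y: "y \<in> A m"
        then have "mass (int m) y = sqrt (mass (int m) y) * sqrt (mass (int m) y)"
          using mass_pos[of y "int m"] A(2)[of m] by (simp add: subset_iff less_imp_le)
        also have "\<dots> \<le> sqrt (a ^ m) * sqrt (mass (int m) y)"
          using y mass_pos[of y "int m"] A(2)[of m]
          by (intro mult_right_mono) (auto simp: A_def subset_iff less_imp_le)
        finally show "mass (int m) y \<le> sqrt (a ^ m) * sqrt (mass (int m) y)" .
      qed
      also have "\<dots> = sqrt a ^ m * (\<Sum>y\<in>A m. sqrt (mass (int m) y))"
        by (simp add: sum_distrib_left real_sqrt_power)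
      also have "\<dots> \<le> sqrt a ^ m * (\<Sum>y\<in>desc x m. sqrt (mass (int m) y))"
        using a desc_subset[OF x, of m] mass_pos[of _ "int m"]
        by (intro mult_left_mono sum_mono2 finite_desc) (auto simp: A_def subset_iff less_imp_le)
      also have "\<dots> \<le> sqrt a ^ m * ((1 + real M * sqrt p) ^ m * sqrt (mass 0 x))"
        using a by (intro mult_left_mono sum_sqrt_mass_desc[OF x]) auto
      finally show ?thesis by (simp add: b_def power_mult_distrib mult_ac)
    qed
    have em: "emeasure code_space (?E m) = ennreal (sum (mass (int m)) (A m))" for m
      by (rule emeasure_node_finite[OF A])
    have nonneg: "0 \<le> sum (mass (int m)) (A m)" for m
      using A(2)[of m] mass_pos[of _ "int m"] by (intro sum_nonneg) (auto simp: subset_iff less_imp_le)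
    have "AE t in code_space. \<forall>\<^sub>F m in sequentially. t \<in> space code_space - ?E m"
    proof (rule borel_cantelli_AE1)
      show "?E m \<in> sets code_space" for m by (rule node_event_sets)
      show "emeasure code_space (?E m) < \<infinity>" for m by (simp add: em)
      have "norm (measure code_space (?E m)) \<le> sqrt (mass 0 x) * b ^ m" for m
        unfolding measure_def em using nonneg[of m] sum_le[of m] by simp
      moreover have "summable (\<lambda>m. sqrt (mass 0 x) * b ^ m)"
        using b by (intro summable_mult summable_geometric) simp
      ultimately show "summable (\<lambda>m. measure code_space (?E m))"
        by (rule summable_comparison_test'[rotated])
    qed
    then show ?thesis
    proof (rule AE_mp, intro AE_I2 impI)
      fix t assume t: "t \<in> space code_space" "node 0 t = x"
        and ev: "\<forall>\<^sub>F m in sequentially. t \<in> space code_space - ?E m"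
      show "\<forall>\<^sub>F m in sequentially. a ^ m \<le> mass (int m) (node (int m) t)"
        using ev
      proof eventually_elim
        case (elim m)
        then show ?case
          using t node_in_desc[of t m] by (auto simp: A_def not_less)
      qed
    qed
  qed
  then have "AE t in code_space. \<forall>x\<in>X 0. node 0 t = x \<longrightarrow>
      (\<forall>\<^sub>F m in sequentially. a ^ m \<le> mass (int m) (node (int m) t))"
    by (subst AE_ball_countable[OF countable_X]) blast
  then show ?thesis
    by (rule AE_mp) (auto intro!: AE_I2 dest: node_in[of _ 0])
qed

text \<open>Replaces a condition on codes by one on points: being near some node of large mass. As a
  countable union of closed balls the set is Borel.\<close>

definition heavy :: "real \<Rightarrow> nat \<Rightarrow> 'a set" where
  "heavy a m = (\<Union>y\<in>{y\<in>X (int m). a ^ m \<le> mass (int m) y}. cball y (2 * mesh (int m)))"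

lemma heavy_borel [measurable]: "heavy a m \<in> sets borel"
  unfolding heavy_def using countable_X[of "int m"]
  by (intro sets.countable_UN' countable_subset[OF _ countable_X[of "int m"]]) auto

lemma \<nu>_heavy:
  assumes "x \<in> heavy a m"
  shows "ennreal (a ^ m) \<le> emeasure \<nu> (cball x (4 * mesh (int m)))"
proof -
  obtain y where y: "y \<in> X (int m)" "a ^ m \<le> mass (int m) y" "dist y x \<le> 2 * mesh (int m)"
    using assms by (auto simp: heavy_def)
  have "cball y (2 * mesh (int m)) \<subseteq> cball x (4 * mesh (int m))"
  proof
    fix z assume "z \<in> cball y (2 * mesh (int m))"
    then show "z \<in> cball x (4 * mesh (int m))"
      using y(3) dist_triangle3[of x z y] by simp
  qed
  then have "ennreal (mass (int m) y) \<le> emeasure \<nu> (cball x (4 * mesh (int m)))"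
    using y(1) by (intro mass_le_\<nu>) auto
  then show ?thesis using ennreal_leI[OF y(2)] by (rule order_trans[rotated])
qed

text \<open>If the node of \<open>t\<close> at level \<open>m\<close> has large mass, then
  \<open>point t\<close>, within two meshes of it, lies in \<open>heavy a m\<close>. So the preimage
  of the exceptional set is null by \<open>AE_mass_node_ge\<close>.\<close>

lemma null_not_eventually_heavy:
  assumes "0 < a" "sqrt a * (1 + real M * sqrt p) < 1"
  shows "outer_measure_of \<nu> {x. \<not> (\<forall>\<^sub>F m in sequentially. x \<in> heavy a m)} = 0"
proof -
  let ?B = "{x. \<not> (\<forall>\<^sub>F m in sequentially. x \<in> heavy a m)}"
  have "?B = (\<Inter>k. \<Union>m\<in>{k..}. - heavy a m)"
    by (auto simp: eventually_sequentially)
  also have "\<dots> \<in> sets borel" by measurable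
  finally have B: "?B \<in> sets borel" .
  have "AE t in code_space. point t \<notin> ?B"
    using AE_mass_node_ge[OF assms]
  proof (rule AE_mp, intro AE_I2 impI)
    fix t assume t: "t \<in> space code_space"
      and ev: "\<forall>\<^sub>F m in sequentially. a ^ m \<le> mass (int m) (node (int m) t)"
    have "\<forall>\<^sub>F m in sequentially. point t \<in> heavy a m"
      using ev
    proof eventually_elim
      case (elim m)
      then show ?case
        using t node_in[of t "int m"] dist_point_node[of t "int m"]
        by (auto simp: heavy_def dist_commute)
    qed
    then show "point t \<notin> ?B" by simp
  qed
  then have "emeasure code_space {t\<in>space code_space. \<not> point t \<notin> ?B} = 0"
    using point_sets[OF B] by (intro AE_iff_measurable[THEN iffD1]) auto
  then show ?thesis
    using B emeasure_\<nu>[OF B] by simp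
qed

text \<open>A ball of radius \<open>t\<close> comparable to \<open>mesh m\<close> has measure at
  least \<open>16 powr (- \<epsilon> * m / 2)\<close>. The factor 1/2 absorbs the bounded ratio of
  \<open>t\<close> to the mesh: \<open>t < 16 powr (- m / 2)\<close> for large \<open>m\<close>, so
  this measure is at least \<open>t powr \<epsilon>\<close>.\<close>

lemma upper_local_dim_le:
  assumes \<epsilon>: "0 < \<epsilon>" and heavy: "\<forall>\<^sub>F m in sequentially. x \<in> heavy (16 powr (- \<epsilon> / 2)) m"
  shows "upper_local_dim (outer_measure_of \<nu>) x \<le> ereal \<epsilon>"
proof -
  obtain k where k: "\<And>m. k \<le> m \<Longrightarrow> x \<in> heavy (16 powr (- \<epsilon> / 2)) m"
    using heavy by (auto simp: eventually_sequentially)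
  \<comment> \<open>The 4 ensures \<open>2 - m \<le> - m / 2\<close>, where the 2 comes from 64
    being at most \<open>16 powr 2\<close>.\<close>
  define K where "K = max k 4"
  have bound: "log_ennreal (outer_measure_of \<nu> (cball x t)) / ereal (ln t) \<le> ereal \<epsilon>"
    if t: "0 < t" "t < mesh (int K)" for t
  proof -
    obtain n where n: "mesh n \<le> t / 4" "t / 4 < 16 * mesh n"
      using mesh_between[of "t / 4"] t(1) by auto
    have "int K < n"
      using mesh_le[of n "int K"] n(1) t by linarith
    then obtain m where m: "n = int m" "K < m"
      by (metis less_trans of_nat_0_le_iff nonneg_int_cases of_nat_less_iff order_less_imp_le le_less_trans)
    have "t < 64 * mesh n" using n(2) by simp
    also have "\<dots> \<le> 16 powr 2 * mesh n" by simp
    also have "\<dots> = 16 powr (2 - real m)"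
      by (simp add: mesh_def m(1) powr_diff powr_minus_divide)
    also have "\<dots> \<le> 16 powr (- real m / 2)"
      using m(2) by (intro powr_mono) (auto simp: K_def)
    finally have tm: "t < 16 powr (- real m / 2)" .
    also have "\<dots> < 16 powr 0"
      using m(2) by (intro powr_less_mono) (auto simp: K_def)
    finally have lnt: "ln t < 0" using t(1) by simp
    have "t powr \<epsilon> \<le> (16 powr (- real m / 2)) powr \<epsilon>"
      using tm t(1) \<epsilon> by (intro powr_mono2) auto
    also have "\<dots> = (16 powr (- \<epsilon> / 2)) ^ m"
      by (simp add: powr_powr powr_realpow[symmetric] mult_ac)
    finally have "ennreal (t powr \<epsilon>) \<le> ennreal ((16 powr (- \<epsilon> / 2)) ^ m)"
      by (rule ennreal_leI)
    also have "\<dots> \<le> emeasure \<nu> (cball x (4 * mesh (int m)))"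
      using k[of m] m(2) by (intro \<nu>_heavy) (simp add: K_def)
    also have "\<dots> \<le> emeasure \<nu> (cball x t)"
      using n(1) m(1) by (intro emeasure_mono subset_cball) auto
    finally have le: "ennreal (t powr \<epsilon>) \<le> emeasure \<nu> (cball x t)" .
    \<comment> \<open>The measure of the ball is finite and positive, so \<open>log_ennreal\<close>
      is the real logarithm here.\<close>
    define u where "u = enn2real (emeasure \<nu> (cball x t))"
    have u: "emeasure \<nu> (cball x t) = ennreal u"
      using \<nu>_cball_doubling(2)[OF t(1), of x] by (simp add: u_def)
    then have upos: "0 < u"
      using \<nu>_cball_doubling(1)[OF t(1), of x] by simp
    then have "t powr \<epsilon> \<le> u" using le u by simp
    then have "ln (t powr \<epsilon>) \<le> ln u"
      using t(1) by (subst ln_le_cancel_iff) (use upos in auto)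
    then have "\<epsilon> * ln t \<le> ln u" using t(1) by (simp add: ln_powr)
    then have "ln u / ln t \<le> \<epsilon>" using lnt by (simp add: neg_divide_le_eq)
    moreover have "log_ennreal (outer_measure_of \<nu> (cball x t)) = ereal (ln u)"
      using u upos by (simp add: log_ennreal_def)
    ultimately show ?thesis using lnt by simp
  qed
  have "\<forall>\<^sub>F t in at_right 0. log_ennreal (outer_measure_of \<nu> (cball x t)) / ereal (ln t) \<le> ereal \<epsilon>"
    unfolding eventually_at_right_field using bound mesh_pos by blast
  then show ?thesis
    unfolding upper_local_dim_def by (rule Limsup_bounded)
qed

end

section \<open>Choice of \<open>p\<close> for a given \<epsilon>\<close>

theorem theorem4p1:
  fixes \<epsilon> :: real
  assumes "doubling_space TYPE('a::complete_space)"
    and "\<epsilon> > 0"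
  shows "\<exists>\<mu> :: 'a set \<Rightarrow> ennreal. doubling_measure \<mu> \<and>
           almost_all \<mu> (\<lambda>x. upper_local_dim \<mu> x \<le> ereal \<epsilon>)"
proof -
  \<comment> \<open>Types are inhabited, which matches the assumption that the space is
    nonempty.\<close>
  fix base :: 'a
  obtain X par cen M where tree: "\<And>p. 0 < p \<Longrightarrow> p * (real M + 1) \<le> 1 \<Longrightarrow>
      net_tree X par cen base p M"
    using net_tree_exists[OF assms(1), of base] by blast
  define a :: real where "a = 16 powr (- \<epsilon> / 2)"
  have "a < 16 powr 0"
    unfolding a_def using assms(2) by (intro powr_less_mono) auto
  then have a: "0 < a" "a < 1" by (simp_all add: a_def)
  then have sa: "0 < sqrt a" "sqrt a < 1" by auto
  \<comment> \<open>The share \<open>p\<close> will be the square of \<open>d\<close>, so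
    \<open>sqrt p = d\<close>. The choice gives \<open>real M * d \<le> 1 - sqrt a\<close>, hence
    \<open>sqrt a * (1 + real M * sqrt p) \<le> sqrt a * (2 - sqrt a)\<close>, which is below
    1.\<close>
  define d where "d = (1 - sqrt a) / (real M + 1)"
  have d: "0 < d" "d * (real M + 1) = 1 - sqrt a"
    using sa by (simp_all add: d_def)
  have "d \<le> d * (real M + 1)" using d(1) by simp
  then have "d \<le> 1" using d(2) sa by linarith
  then have "d\<^sup>2 * (real M + 1) \<le> d * (real M + 1)"
    using d(1) by (intro mult_right_mono) (auto simp: power2_eq_square mult_left_le)
  then have "d\<^sup>2 * (real M + 1) \<le> 1" using d(2) sa by linarith
  then interpret net_tree X par cen base "d\<^sup>2" M
    using d(1) by (intro tree) auto
  have "real M * sqrt (d\<^sup>2) \<le> 1 - sqrt a"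
    using d by (simp add: algebra_simps)
  then have "sqrt a * (1 + real M * sqrt (d\<^sup>2)) \<le> sqrt a * (2 - sqrt a)"
    using sa by (intro mult_left_mono) auto
  also have "\<dots> = 1 - (1 - sqrt a)\<^sup>2"
    by (simp add: power2_eq_square algebra_simps)
  also have "\<dots> < 1" using sa by simp
  finally have null: "outer_measure_of \<nu> {x. \<not> (\<forall>\<^sub>F m in sequentially. x \<in> heavy a m)} = 0"
    by (rule null_not_eventually_heavy[OF a(1)])
  \<comment> \<open>The exceptional set need not be Borel; monotonicity of the outer measure under
    inclusion in a null set suffices.\<close>
  have "{x. \<not> upper_local_dim (outer_measure_of \<nu>) x \<le> ereal \<epsilon>}
      \<subseteq> {x. \<not> (\<forall>\<^sub>F m in sequentially. x \<in> heavy a m)}"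
    using upper_local_dim_le[OF assms(2)] by (auto simp: a_def)
  from outer_measure_of_mono[OF this, of \<nu>]
  have "almost_all (outer_measure_of \<nu>) (\<lambda>x. upper_local_dim (outer_measure_of \<nu>) x \<le> ereal \<epsilon>)"
    by (simp add: almost_all_def null)
  then show ?thesis
    using doubling_measure_\<nu> by blast
qed

end
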